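(* Let $(X,M_1,*_1)$ and $(Y,M_2,*_2)$ be uniformly locally finite fuzzy metric spaces (with $*_1,*_2$ having no zero divisors), and let $f:X\to Y$ be a coarse equivalence. Then $(X,M_1,*_1)$ has property A if and only if $(Y,M_2,*_2)$ has property A.
   Context: A continuous $t$-norm is a continuous, associative, commutative binary operation $*$ on $[0,1]$ with $a*1=a$ for all $a$, and $a*b\leq c*d$ whenever $a\leq c$ and $b\leq d$. Standing assumption: $t$-norms have no zero divisors, i.e. $a*b\neq 0$ whenever $a\neq 0$ and $b\neq 0$. A fuzzy metric space (George–Veeramani) is a triple $(X,M,* )$ with $X$ a set, $*$ a continuous $t$-norm, and $M:X\times X\times(0,\infty)\to[0,1]$ such that for all $x,y,z\in X$ and $s,t>0$: (1) $M(x,y,t)>0$; (2) $M(x,y,t)=1$ if and only if $x=y$; (3) $M(x,y,t)=M(y,x,t)$; (4) $M(x,y,t)*M(y,z,s)\leq M(x,z,t+s)$; (5) $M(x,y,\cdot)$ is continuous on $(0,\infty)$. For $x\in X$, $r\in(0,1)$, $t>0$, the ball is $B(x,r,t)=\{y\in X:M(x,y,t)>1-r\}$. The space is uniformly locally finite if for every $r\in(0,1)$ and $t>0$ there is $N_{r,t}>0$ with $|B(x,r,t)|<N_{r,t}$ for all $x\in X$. A uniformly locally finite fuzzy metric space $(X,M,* )$ has property A if for every $\varepsilon>0$, $t>0$, $r\in(0,1)$ there exist $t'>0$, $r'\in(0,1)$ and a family $\{A_x\}_{x\in X}$ of non-empty finite subsets of $X\times\mathbb{N}$ such that $A_x\subset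 B(x,r',t')\times\mathbb{N}$ for each $x$, and $|A_x\Delta A_y|<\varepsilon|A_x\cap A_y|$ whenever $M(x,y,t)>1-r$. Here $\Delta$ is symmetric difference. A map $f:X\to Y$ between fuzzy metric spaces $(X,M_1,*_1)$, $(Y,M_2,*_2)$ is: uniformly expansive if for all $A>0$ and $t>0$ there exist $B\in(0,1)$ and $t'>0$ such that $M_2(f(x),f(x'),t')\geq B$ whenever $M_1(x,x',t)\geq A$; effectively proper if for all $C>0$ and $t>0$ there exist $D\in(0,1)$ and $t'>0$ such that $M_1(x,x',t')\geq D$ whenever $M_2(f(x),f(x'),t)\geq C$; a coarse embedding if it is both uniformly expansive and effectively proper; a coarse equivalence if it is a coarse embedding and there exist $r\in(0,1)$ and $t>0$ such that for each $y\in Y$ there is $x\in X$ with $M_2(f(x),y,t)>1-r$. *)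

theory Defs
  imports Complex_Main "HOL-Library.FuncSet"
begin

text \<open>
  A t-norm is a total function on the reals of which only the values on the unit interval matter;
  likewise a fuzzy metric \<open>M x y t\<close> only matters for points of the carrier and \<open>t > 0\<close>.
\<close>

locale continuous_tnorm =
  fixes T :: "real \<Rightarrow> real \<Rightarrow> real"  (infixl \<open>\<star>\<close> 70)
  assumes closed: "\<lbrakk>a \<in> {0..1}; b \<in> {0..1}\<rbrakk> \<Longrightarrow> a \<star> b \<in> {0..1}"
    and continuous: "continuous_on ({0..1} \<times> {0..1}) (\<lambda>(a, b). a \<star> b)"
    and assoc: "\<lbrakk>a \<in> {0..1}; b \<in> {0..1}; c \<in> {0..1}\<rbrakk> \<Longrightarrow> (a \<star> b) \<star> c = a \<star> (b \<star> c)"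
    and commute: "\<lbrakk>a \<in> {0..1}; b \<in> {0..1}\<rbrakk> \<Longrightarrow> a \<star> b = b \<star> a"
    and right_unit: "a \<in> {0..1} \<Longrightarrow> a \<star> 1 = a"
    and mono: "\<lbrakk>a \<in> {0..1}; b \<in> {0..1}; c \<in> {0..1}; d \<in> {0..1}; a \<le> c; b \<le> d\<rbrakk>
                 \<Longrightarrow> a \<star> b \<le> c \<star> d"

definition tnorm_no_zero_divisors :: "(real \<Rightarrow> real \<Rightarrow> real) \<Rightarrow> bool" where
  "tnorm_no_zero_divisors T \<longleftrightarrow>
     (\<forall>a\<in>{0..1}. \<forall>b\<in>{0..1}. a \<noteq> 0 \<longrightarrow> b \<noteq> 0 \<longrightarrow> T a b \<noteq> 0)"

locale fuzzy_metric_space = continuous_tnorm T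
  for X :: "'a set"
    and M :: "'a \<Rightarrow> 'a \<Rightarrow> real \<Rightarrow> real"
    and T :: "real \<Rightarrow> real \<Rightarrow> real"  (infixl \<open>\<star>\<close> 70) +
  assumes range: "\<lbrakk>x \<in> X; y \<in> X; t > 0\<rbrakk> \<Longrightarrow> M x y t \<in> {0..1}"
    and pos: "\<lbrakk>x \<in> X; y \<in> X; t > 0\<rbrakk> \<Longrightarrow> M x y t > 0"
    and eq_1_iff: "\<lbrakk>x \<in> X; y \<in> X; t > 0\<rbrakk> \<Longrightarrow> M x y t = 1 \<longleftrightarrow> x = y"
    and sym: "\<lbrakk>x \<in> X; y \<in> X; t > 0\<rbrakk> \<Longrightarrow> M x y t = M y x t"
    and triangle: "\<lbrakk>x \<in> X; y \<in> X; z \<in> X; s > 0; t > 0\<rbrakk>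
                     \<Longrightarrow> M x y t \<star> M y z s \<le> M x z (t + s)"
    and continuous_time: "\<lbrakk>x \<in> X; y \<in> X\<rbrakk> \<Longrightarrow> continuous_on {0<..} (M x y)"

definition fuzzy_ball ::
    "'a set \<Rightarrow> ('a \<Rightarrow> 'a \<Rightarrow> real \<Rightarrow> real) \<Rightarrow> 'a \<Rightarrow> real \<Rightarrow> real \<Rightarrow> 'a set" where
  "fuzzy_ball X M x r t = {y \<in> X. M x y t > 1 - r}"

definition uniformly_locally_finite ::
    "'a set \<Rightarrow> ('a \<Rightarrow> 'a \<Rightarrow> real \<Rightarrow> real) \<Rightarrow> bool" where
  "uniformly_locally_finite X M \<longleftrightarrow>
     (\<forall>r\<in>{0<..<1}. \<forall>t>0. \<exists>N::nat. N > 0 \<and>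
        (\<forall>x\<in>X. finite (fuzzy_ball X M x r t) \<and> card (fuzzy_ball X M x r t) < N))"

definition property_A ::
    "'a set \<Rightarrow> ('a \<Rightarrow> 'a \<Rightarrow> real \<Rightarrow> real) \<Rightarrow> bool" where
  "property_A X M \<longleftrightarrow>
     (\<forall>\<epsilon>::real. \<forall>t>0. \<forall>r\<in>{0<..<1}. \<epsilon> > 0 \<longrightarrow>
        (\<exists>t'>0. \<exists>r'\<in>{0<..<1}. \<exists>A :: 'a \<Rightarrow> ('a \<times> nat) set.
           (\<forall>x\<in>X. A x \<noteq> {} \<and> finite (A x) \<and> A x \<subseteq> fuzzy_ball X M x r' t' \<times> UNIV) \<and>
           (\<forall>x\<in>X. \<forall>y\<in>X. M x y t > 1 - r \<longrightarrow>
              real (card (sym_diff (A x) (A y))) < \<epsilon> * real (card (A x \<inter> A y)))))"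

definition uniformly_expansive ::
    "'a set \<Rightarrow> ('a \<Rightarrow> 'a \<Rightarrow> real \<Rightarrow> real) \<Rightarrow> ('b \<Rightarrow> 'b \<Rightarrow> real \<Rightarrow> real) \<Rightarrow> ('a \<Rightarrow> 'b) \<Rightarrow> bool" where
  "uniformly_expansive X M\<^sub>1 M\<^sub>2 f \<longleftrightarrow>
     (\<forall>A>0. \<forall>t>0. \<exists>B\<in>{0<..<1}. \<exists>t'>0.
        \<forall>x\<in>X. \<forall>x'\<in>X. M\<^sub>1 x x' t \<ge> A \<longrightarrow> M\<^sub>2 (f x) (f x') t' \<ge> B)"

definition effectively_proper ::
    "'a set \<Rightarrow> ('a \<Rightarrow> 'a \<Rightarrow> real \<Rightarrow> real) \<Rightarrow> ('b \<Rightarrow> 'b \<Rightarrow> real \<Rightarrow> real) \<Rightarrow> ('a \<Rightarrow> 'b) \<Rightarrow> bool" where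
  "effectively_proper X M\<^sub>1 M\<^sub>2 f \<longleftrightarrow>
     (\<forall>C>0. \<forall>t>0. \<exists>D\<in>{0<..<1}. \<exists>t'>0.
        \<forall>x\<in>X. \<forall>x'\<in>X. M\<^sub>2 (f x) (f x') t \<ge> C \<longrightarrow> M\<^sub>1 x x' t' \<ge> D)"

definition coarse_embedding ::
    "'a set \<Rightarrow> ('a \<Rightarrow> 'a \<Rightarrow> real \<Rightarrow> real) \<Rightarrow> ('b \<Rightarrow> 'b \<Rightarrow> real \<Rightarrow> real) \<Rightarrow> ('a \<Rightarrow> 'b) \<Rightarrow> bool" where
  "coarse_embedding X M\<^sub>1 M\<^sub>2 f \<longleftrightarrow>
     uniformly_expansive X M\<^sub>1 M\<^sub>2 f \<and> effectively_proper X M\<^sub>1 M\<^sub>2 f"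

definition coarse_equivalence ::
    "'a set \<Rightarrow> ('a \<Rightarrow> 'a \<Rightarrow> real \<Rightarrow> real) \<Rightarrow> 'b set \<Rightarrow> ('b \<Rightarrow> 'b \<Rightarrow> real \<Rightarrow> real) \<Rightarrow> ('a \<Rightarrow> 'b) \<Rightarrow> bool"
  where
  "coarse_equivalence X M\<^sub>1 Y M\<^sub>2 f \<longleftrightarrow>
     coarse_embedding X M\<^sub>1 M\<^sub>2 f \<and>
     (\<exists>r\<in>{0<..<1}. \<exists>t>0. \<forall>y\<in>Y. \<exists>x\<in>X. M\<^sub>2 (f x) y t > 1 - r)"

end

theory Submission
  imports Defs "HOL-Library.Countable_Set"
begin

text \<open>
  Property A pulls back along any coarse embedding \<open>f\<close> into a uniformly locally finite space:
  the sets \<open>A (f x)\<close> are transported by an injection \<open>(y, n) \<mapsto> (p y, code y n)\<close>, where \<open>p y\<close> is a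
  chosen point whose image is close to \<open>y\<close> and \<open>code\<close> also records the position of \<open>y\<close> in the
  finite ball around \<open>f (p y)\<close>, so that \<open>y\<close> can be recovered; an injection preserves the
  cardinalities of symmetric differences and intersections. A coarse equivalence has a coarse
  embedding in the opposite direction, so this applies both ways.
\<close>

text \<open>The product of two positive lower bounds stays positive because the t-norm has no zero
  divisors, so it bounds \<open>M x z (s + t)\<close> from below by monotonicity and the triangle
  inequality. The point is that \<open>c\<close> depends on \<open>a\<close> and \<open>b\<close>
  only, never on the points.\<close>

lemma (in fuzzy_metric_space) uniform_triangle:
  assumes nzd: "tnorm_no_zero_divisors T" and "a > 0" "b > 0" "s > 0" "t > 0"
  obtains c where "c \<in> {0<..<1}"
    and "\<And>x y z. \<lbrakk>x \<in> X; y \<in> X; z \<in> X; M x y s \<ge> a; M y z t \<ge> b\<rbrakk> \<Longrightarrow> M x z (s + t) \<ge> c"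
proof
  \<comment> \<open>The thresholds may exceed 1, whereas the t-norm axioms speak only of the unit
    interval; cutting off at 1 keeps them positive and below the values of \<open>M\<close>.\<close>
  define a' where "a' = min a 1"
  define b' where "b' = min b 1"
  \<comment> \<open>The product can equal 1; the minimum with 1/2 puts \<open>c\<close> in the open
    interval, and a smaller lower bound remains valid.\<close>
  define c where "c = min (a' \<star> b') (1/2)"
  have ab: "a' \<in> {0..1}" "b' \<in> {0..1}" "a' \<noteq> 0" "b' \<noteq> 0"
    using assms by (auto simp: a'_def b'_def)
  then have "a' \<star> b' \<noteq> 0" "a' \<star> b' \<in> {0..1}"
    using nzd closed by (auto simp: tnorm_no_zero_divisors_def)
  then show "c \<in> {0<..<1}"
    by (auto simp: c_def)
  fix x y z assume xyz: "x \<in> X" "y \<in> X" "z \<in> X" and "M x y s \<ge> a" "M y z t \<ge> b"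
  then have "a' \<le> M x y s" "b' \<le> M y z t"
    by (auto simp: a'_def b'_def)
  then have "a' \<star> b' \<le> M x y s \<star> M y z t"
    using ab range xyz \<open>s > 0\<close> \<open>t > 0\<close> by (intro mono) auto
  also have "\<dots> \<le> M x z (s + t)"
    using xyz \<open>s > 0\<close> \<open>t > 0\<close> by (intro triangle)
  finally show "M x z (s + t) \<ge> c"
    by (simp add: c_def)
qed

text \<open>Two uses of \<open>uniform_triangle\<close>. Chains of four points occur when two points
  are compared with their images under a map close to the identity.\<close>

lemma (in fuzzy_metric_space) uniform_triangle_3:
  assumes nzd: "tnorm_no_zero_divisors T" and "a > 0" "b > 0" "c > 0" "s > 0" "t > 0" "u > 0"
  obtains d where "d \<in> {0<..<1}"
    and "\<And>w x y z. \<lbrakk>w \<in> X; x \<in> X; y \<in> X; z \<in> X; M w x s \<ge> a; M x y t \<ge> b; M y z u \<ge> c\<rbrakk>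
            \<Longrightarrow> M w z (s + t + u) \<ge> d"
proof -
  obtain e where e: "e \<in> {0<..<1}"
      "\<And>w x y. \<lbrakk>w \<in> X; x \<in> X; y \<in> X; M w x s \<ge> a; M x y t \<ge> b\<rbrakk> \<Longrightarrow> M w y (s + t) \<ge> e"
    using uniform_triangle[OF nzd \<open>a > 0\<close> \<open>b > 0\<close> \<open>s > 0\<close> \<open>t > 0\<close>] by blast
  have "e > 0" "s + t > 0"
    using e(1) assms by auto
  then obtain d where "d \<in> {0<..<1}"
      "\<And>w y z. \<lbrakk>w \<in> X; y \<in> X; z \<in> X; M w y (s + t) \<ge> e; M y z u \<ge> c\<rbrakk>
         \<Longrightarrow> M w z (s + t + u) \<ge> d"
    using uniform_triangle[OF nzd _ \<open>c > 0\<close> _ \<open>u > 0\<close>] by metis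
  with e(2) show thesis
    by (intro that) blast+
qed

lemma uniformly_expansiveE:
  assumes "uniformly_expansive X M\<^sub>1 M\<^sub>2 f" and "a > 0" and "t > 0"
  obtains b t' where "b \<in> {0<..<1}" and "t' > 0"
    and "\<And>x x'. \<lbrakk>x \<in> X; x' \<in> X; M\<^sub>1 x x' t \<ge> a\<rbrakk> \<Longrightarrow> M\<^sub>2 (f x) (f x') t' \<ge> b"
  using assms(1)[unfolded uniformly_expansive_def, rule_format, OF assms(2,3)] by blast

lemma effectively_properE:
  assumes "effectively_proper X M\<^sub>1 M\<^sub>2 f" and "c > 0" and "t > 0"
  obtains d t' where "d \<in> {0<..<1}" and "t' > 0"
    and "\<And>x x'. \<lbrakk>x \<in> X; x' \<in> X; M\<^sub>2 (f x) (f x') t \<ge> c\<rbrakk> \<Longrightarrow> M\<^sub>1 x x' t' \<ge> d"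
  using assms(1)[unfolded effectively_proper_def, rule_format, OF assms(2,3)] by blast

text \<open>The first component of the value determines \<open>p y\<close>, hence the set
  \<open>F (p y)\<close> and its enumeration; decoding the second component then gives
  \<open>n\<close> and the position of \<open>y\<close> in that enumeration, which identifies
  \<open>y\<close>.\<close>

lemma inj_on_countable_fibres:
  assumes "\<And>y. y \<in> E \<Longrightarrow> countable (F (p y))" and "\<And>y. y \<in> E \<Longrightarrow> y \<in> F (p y)"
  shows "inj_on (\<lambda>(y, n). (p y, prod_encode (to_nat_on (F (p y)) y, n))) (E \<times> UNIV)"
proof (rule inj_onI, clarsimp)
  fix y z assume "y \<in> E" "z \<in> E" "p y = p z" "to_nat_on (F (p z)) y = to_nat_on (F (p z)) z"
  then show "y = z"
    using assms to_nat_on_inj by metis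
qed

lemma property_A_coarse_embedding:
  fixes X :: "'a set" and Y :: "'b set"
  assumes Y: "fuzzy_metric_space Y M\<^sub>2 T\<^sub>2" and nzd: "tnorm_no_zero_divisors T\<^sub>2"
    and ulf: "uniformly_locally_finite Y M\<^sub>2"
    and f: "f \<in> X \<rightarrow> Y" and emb: "coarse_embedding X M\<^sub>1 M\<^sub>2 f"
    and A: "property_A Y M\<^sub>2"
  shows "property_A X M\<^sub>1"
  unfolding property_A_def
proof (intro allI impI ballI)
  interpret fuzzy_metric_space Y M\<^sub>2 T\<^sub>2 by (rule Y)
  have expansive: "uniformly_expansive X M\<^sub>1 M\<^sub>2 f" and proper: "effectively_proper X M\<^sub>1 M\<^sub>2 f"
    using emb by (auto simp: coarse_embedding_def)
  fix \<epsilon> t r :: real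
  assume "t > 0" "r \<in> {0<..<1}" "\<epsilon> > 0"
  have "1 - r > 0"
    using \<open>r \<in> {0<..<1}\<close> by simp
  then obtain B t\<^sub>1 where B: "B \<in> {0<..<1}" and "t\<^sub>1 > 0"
    and exp: "\<And>x x'. \<lbrakk>x \<in> X; x' \<in> X; M\<^sub>1 x x' t \<ge> 1 - r\<rbrakk> \<Longrightarrow> M\<^sub>2 (f x) (f x') t\<^sub>1 \<ge> B"
    using uniformly_expansiveE[OF expansive _ \<open>t > 0\<close>] by blast
  \<comment> \<open>Radius \<open>1 - B / 2\<close> means threshold \<open>B / 2\<close>.
    Expansiveness yields only \<open>\<ge> B\<close>, while property A asks for a strict inequality;
    halving bridges the gap.\<close>
  have B': "1 - B / 2 \<in> {0<..<1}"
    using B by auto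
  obtain t' r' and A :: "'b \<Rightarrow> ('b \<times> nat) set"
    where "t' > 0" and r': "r' \<in> {0<..<1}"
    and A_sub: "\<forall>y\<in>Y. A y \<noteq> {} \<and> finite (A y) \<and> A y \<subseteq> fuzzy_ball Y M\<^sub>2 y r' t' \<times> UNIV"
    and A_diff: "\<forall>y\<in>Y. \<forall>y'\<in>Y. M\<^sub>2 y y' t\<^sub>1 > 1 - (1 - B / 2) \<longrightarrow>
          real (card (sym_diff (A y) (A y'))) < \<epsilon> * real (card (A y \<inter> A y'))"
    using A[unfolded property_A_def, rule_format, OF \<open>t\<^sub>1 > 0\<close> B' \<open>\<epsilon> > 0\<close>]
    by (elim exE bexE conjE) (rule that)
  have "1 - r' > 0"
    using r' by simp
  obtain C where C: "C \<in> {0<..<1}"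
    and tri: "\<And>x y z. \<lbrakk>x \<in> Y; y \<in> Y; z \<in> Y; M\<^sub>2 x y t' \<ge> 1 - r'; M\<^sub>2 y z t' \<ge> 1 - r'\<rbrakk>
                \<Longrightarrow> M\<^sub>2 x z (t' + t') \<ge> C"
    using uniform_triangle[OF nzd \<open>1 - r' > 0\<close> \<open>1 - r' > 0\<close> \<open>t' > 0\<close> \<open>t' > 0\<close>] by blast
  have "C > 0" "t' + t' > 0"
    using C \<open>t' > 0\<close> by auto
  then obtain D t\<^sub>2 where D: "D \<in> {0<..<1}" and "t\<^sub>2 > 0"
    and proper_f: "\<And>x x'. \<lbrakk>x \<in> X; x' \<in> X; M\<^sub>2 (f x) (f x') (t' + t') \<ge> C\<rbrakk> \<Longrightarrow> M\<^sub>1 x x' t\<^sub>2 \<ge> D"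
    using effectively_properE[OF proper] by blast
  define F where "F x = fuzzy_ball Y M\<^sub>2 (f x) r' t'" for x
  \<comment> \<open>\<open>E\<close> holds the first components of all the sets
    \<open>A (f x)\<close>, and each of its points is near the image of some point of
    \<open>X\<close>, so \<open>p\<close> can choose one. The choice depends on \<open>y\<close>
    alone, not on the \<open>x\<close> at hand; hence one injection \<open>h\<close> serves all the
    sets at once and respects their overlaps.\<close>
  define E where "E = (\<Union>x\<in>X. F x)"
  define p where "p y = (SOME x. x \<in> X \<and> y \<in> F x)" for y
  have p: "p y \<in> X \<and> y \<in> F (p y)" if "y \<in> E" for y
    unfolding p_def by (rule someI_ex) (use that in \<open>auto simp: E_def\<close>)
  \<comment> \<open>This is where local finiteness of \<open>Y\<close> enters: it makes
    \<open>to_nat_on\<close> injective on each ball.\<close>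
  have countable_F: "countable (F x)" if "x \<in> X" for x
    using ulf[unfolded uniformly_locally_finite_def, rule_format, OF r' \<open>t' > 0\<close>]
      funcset_mem[OF f that] by (auto simp: F_def intro: countable_finite)
  define h where "h = (\<lambda>(y, n). (p y, prod_encode (to_nat_on (F (p y)) y, n)))"
  have inj: "inj_on h (E \<times> UNIV)"
    unfolding h_def by (rule inj_on_countable_fibres) (simp_all add: countable_F p)
  have Ax: "A (f x) \<noteq> {}" "finite (A (f x))" "A (f x) \<subseteq> F x \<times> UNIV" if "x \<in> X" for x
    using A_sub[rule_format, OF funcset_mem[OF f that]] by (auto simp: F_def)
  then have A_E: "A (f x) \<subseteq> E \<times> UNIV" if "x \<in> X" for x
    using that by (fastforce simp: E_def)
  \<comment> \<open>Both \<open>f x\<close> and \<open>f (p y)\<close> are close to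
    \<open>y\<close>, hence close to each other, and effective properness carries this back to
    \<open>x\<close> and \<open>p y\<close>. Again \<open>D / 2\<close> turns \<open>\<ge> D\<close>
    into the strict inequality of a ball.\<close>
  have near: "p y \<in> fuzzy_ball X M\<^sub>1 x (1 - D / 2) t\<^sub>2" if "x \<in> X" "y \<in> F x" for x y
  proof -
    have py: "p y \<in> X" "y \<in> F (p y)"
      using p that by (auto simp: E_def)
    have Y': "f x \<in> Y" "y \<in> Y" "f (p y) \<in> Y"
      using that py f by (auto simp: F_def fuzzy_ball_def)
    have "M\<^sub>2 (f x) (f (p y)) (t' + t') \<ge> C"
      using Y' that py sym[OF Y'(2,3) \<open>t' > 0\<close>]
      by (intro tri[of "f x" y]) (auto simp: F_def fuzzy_ball_def)
    then have "M\<^sub>1 x (p y) t\<^sub>2 \<ge> D"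
      using proper_f that py by blast
    then show ?thesis
      using py D by (auto simp: fuzzy_ball_def)
  qed
  have "\<forall>x\<in>X. h ` A (f x) \<noteq> {} \<and> finite (h ` A (f x)) \<and>
          h ` A (f x) \<subseteq> fuzzy_ball X M\<^sub>1 x (1 - D / 2) t\<^sub>2 \<times> UNIV"
  proof
    fix x assume x: "x \<in> X"
    have "h ` A (f x) \<subseteq> fuzzy_ball X M\<^sub>1 x (1 - D / 2) t\<^sub>2 \<times> UNIV"
      using near[OF x] Ax(3)[OF x] by (auto simp: h_def)
    with Ax[OF x] show "h ` A (f x) \<noteq> {} \<and> finite (h ` A (f x)) \<and>
        h ` A (f x) \<subseteq> fuzzy_ball X M\<^sub>1 x (1 - D / 2) t\<^sub>2 \<times> UNIV"
      by simp
  qed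
  moreover have "\<forall>x\<in>X. \<forall>y\<in>X. M\<^sub>1 x y t > 1 - r \<longrightarrow>
      real (card (sym_diff (h ` A (f x)) (h ` A (f y))))
        < \<epsilon> * real (card (h ` A (f x) \<inter> h ` A (f y)))"
  proof (intro ballI impI)
    fix x y assume xy: "x \<in> X" "y \<in> X" "M\<^sub>1 x y t > 1 - r"
    note sub = A_E[OF xy(1)] A_E[OF xy(2)]
    \<comment> \<open>Images commute with differences here since \<open>h\<close> is injective on
      \<open>E \<times> UNIV\<close>, which contains both sets.\<close>
    have "sym_diff (h ` A (f x)) (h ` A (f y)) = h ` sym_diff (A (f x)) (A (f y))"
      using inj_on_image_set_diff[OF inj] sub by (simp add: image_Un Diff_subset[THEN subset_trans])
    then have "card (sym_diff (h ` A (f x)) (h ` A (f y))) = card (sym_diff (A (f x)) (A (f y)))"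
      using sub by (auto intro!: card_image inj_on_subset[OF inj])
    moreover have "card (h ` A (f x) \<inter> h ` A (f y)) = card (A (f x) \<inter> A (f y))"
      unfolding inj_on_image_Int[OF inj sub, symmetric]
      using sub by (auto intro!: card_image inj_on_subset[OF inj])
    moreover have "M\<^sub>2 (f x) (f y) t\<^sub>1 > 1 - (1 - B / 2)"
      using exp[of x y] xy B by auto
    ultimately show "real (card (sym_diff (h ` A (f x)) (h ` A (f y))))
        < \<epsilon> * real (card (h ` A (f x) \<inter> h ` A (f y)))"
      using A_diff[rule_format, of "f x" "f y"] xy f by auto
  qed
  moreover have "1 - D / 2 \<in> {0<..<1}"
    using D by auto
  ultimately show "\<exists>t'>0. \<exists>r'\<in>{0<..<1}. \<exists>A :: 'a \<Rightarrow> ('a \<times> nat) set.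
      (\<forall>x\<in>X. A x \<noteq> {} \<and> finite (A x) \<and> A x \<subseteq> fuzzy_ball X M\<^sub>1 x r' t' \<times> UNIV) \<and>
      (\<forall>x\<in>X. \<forall>y\<in>X. M\<^sub>1 x y t > 1 - r \<longrightarrow>
         real (card (sym_diff (A x) (A y))) < \<epsilon> * real (card (A x \<inter> A y)))"
    using \<open>t\<^sub>2 > 0\<close> by (intro exI[of _ t\<^sub>2] conjI bexI[of _ "1 - D / 2"] exI[of _ "\<lambda>x. h ` A (f x)"])
qed

text \<open>Let \<open>g\<close> send \<open>y\<close> to a point whose image under \<open>f\<close>
  is near \<open>y\<close>, so that \<open>f\<close> after \<open>g\<close> is uniformly close to
  the identity of \<open>Y\<close>. The two halves of being a coarse embedding then swap roles:
  effective properness of \<open>f\<close> makes \<open>g\<close> expansive, and expansiveness of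
  \<open>f\<close> makes \<open>g\<close> effectively proper.\<close>

lemma coarse_equivalence_inverse:
  assumes Y: "fuzzy_metric_space Y M\<^sub>2 T\<^sub>2" and nzd: "tnorm_no_zero_divisors T\<^sub>2"
    and f: "f \<in> X \<rightarrow> Y" and equiv: "coarse_equivalence X M\<^sub>1 Y M\<^sub>2 f"
  obtains g where "g \<in> Y \<rightarrow> X" and "coarse_embedding Y M\<^sub>2 M\<^sub>1 g"
proof -
  interpret fuzzy_metric_space Y M\<^sub>2 T\<^sub>2 by (rule Y)
  obtain r t\<^sub>0 where r: "r \<in> {0<..<1}" and "t\<^sub>0 > 0"
    and "\<forall>y\<in>Y. \<exists>x\<in>X. M\<^sub>2 (f x) y t\<^sub>0 > 1 - r"
    using equiv unfolding coarse_equivalence_def by blast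
  then obtain g where g: "\<And>y. y \<in> Y \<Longrightarrow> g y \<in> X"
    and close: "\<And>y. y \<in> Y \<Longrightarrow> M\<^sub>2 (f (g y)) y t\<^sub>0 > 1 - r"
    by metis
  have fg: "f (g y) \<in> Y" if "y \<in> Y" for y
    using f g that by auto
  have close': "M\<^sub>2 y (f (g y)) t\<^sub>0 > 1 - r" if "y \<in> Y" for y
    using close[OF that] sym[OF that fg[OF that] \<open>t\<^sub>0 > 0\<close>] by simp
  have emb: "uniformly_expansive X M\<^sub>1 M\<^sub>2 f" "effectively_proper X M\<^sub>1 M\<^sub>2 f"
    using equiv by (auto simp: coarse_equivalence_def coarse_embedding_def)
  have "1 - r > 0"
    using r by simp
  have "uniformly_expansive Y M\<^sub>2 M\<^sub>1 g"
    unfolding uniformly_expansive_def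
  proof (intro allI impI)
    fix A t :: real assume "A > 0" "t > 0"
    \<comment> \<open>To be used along the chain \<open>f (g y)\<close>, \<open>y\<close>,
      \<open>y'\<close>, \<open>f (g y')\<close>, whose outer links come from the choice of
      \<open>g\<close> and whose middle link is the assumed closeness.\<close>
    obtain C where C: "C \<in> {0<..<1}"
      and tri: "\<And>w x y z. \<lbrakk>w \<in> Y; x \<in> Y; y \<in> Y; z \<in> Y; M\<^sub>2 w x t\<^sub>0 \<ge> 1 - r; M\<^sub>2 x y t \<ge> A;
                  M\<^sub>2 y z t\<^sub>0 \<ge> 1 - r\<rbrakk> \<Longrightarrow> M\<^sub>2 w z (t\<^sub>0 + t + t\<^sub>0) \<ge> C"
      using uniform_triangle_3[OF nzd \<open>1 - r > 0\<close> \<open>A > 0\<close> \<open>1 - r > 0\<close> \<open>t\<^sub>0 > 0\<close> \<open>t > 0\<close> \<open>t\<^sub>0 > 0\<close>]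
      by blast
    have "C > 0" "t\<^sub>0 + t + t\<^sub>0 > 0"
      using C \<open>t\<^sub>0 > 0\<close> \<open>t > 0\<close> by auto
    then obtain D t' where "D \<in> {0<..<1}" "t' > 0"
      and proper: "\<And>x x'. \<lbrakk>x \<in> X; x' \<in> X; M\<^sub>2 (f x) (f x') (t\<^sub>0 + t + t\<^sub>0) \<ge> C\<rbrakk> \<Longrightarrow> M\<^sub>1 x x' t' \<ge> D"
      using effectively_properE[OF emb(2)] by blast
    have "M\<^sub>1 (g y) (g y') t' \<ge> D" if "y \<in> Y" "y' \<in> Y" "M\<^sub>2 y y' t \<ge> A" for y y'
      using that by (intro proper g tri[of _ y y'] fg less_imp_le[OF close] less_imp_le[OF close'])
    with \<open>D \<in> {0<..<1}\<close> \<open>t' > 0\<close> show "\<exists>B\<in>{0<..<1}. \<exists>t'>0. \<forall>y\<in>Y. \<forall>y'\<in>Y. M\<^sub>2 y y' t \<ge> A \<longrightarrow> M\<^sub>1 (g y) (g y') t' \<ge> B"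
      by blast
  qed
  moreover have "effectively_proper Y M\<^sub>2 M\<^sub>1 g"
    unfolding effectively_proper_def
  proof (intro allI impI)
    fix C t :: real assume "C > 0" "t > 0"
    then obtain B t' where B: "B \<in> {0<..<1}" and "t' > 0"
      and exp: "\<And>x x'. \<lbrakk>x \<in> X; x' \<in> X; M\<^sub>1 x x' t \<ge> C\<rbrakk> \<Longrightarrow> M\<^sub>2 (f x) (f x') t' \<ge> B"
      using uniformly_expansiveE[OF emb(1)] by blast
    have "B > 0"
      using B by simp
    \<comment> \<open>The chain now runs the other way, \<open>y\<close>, \<open>f (g y)\<close>,
      \<open>f (g y')\<close>, \<open>y'\<close>; its middle link comes from expansiveness of
      \<open>f\<close>.\<close>
    obtain D where "D \<in> {0<..<1}"
      and tri: "\<And>w x y z. \<lbrakk>w \<in> Y; x \<in> Y; y \<in> Y; z \<in> Y; M\<^sub>2 w x t\<^sub>0 \<ge> 1 - r; M\<^sub>2 x y t' \<ge> B;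
                  M\<^sub>2 y z t\<^sub>0 \<ge> 1 - r\<rbrakk> \<Longrightarrow> M\<^sub>2 w z (t\<^sub>0 + t' + t\<^sub>0) \<ge> D"
      using uniform_triangle_3[OF nzd \<open>1 - r > 0\<close> \<open>B > 0\<close> \<open>1 - r > 0\<close> \<open>t\<^sub>0 > 0\<close> \<open>t' > 0\<close> \<open>t\<^sub>0 > 0\<close>]
      by blast
    have "M\<^sub>2 y y' (t\<^sub>0 + t' + t\<^sub>0) \<ge> D" if "y \<in> Y" "y' \<in> Y" "M\<^sub>1 (g y) (g y') t \<ge> C" for y y'
      using that
      by (intro tri[of y "f (g y)" "f (g y')"] exp g fg less_imp_le[OF close] less_imp_le[OF close'])
    moreover have "t\<^sub>0 + t' + t\<^sub>0 > 0"
      using \<open>t\<^sub>0 > 0\<close> \<open>t' > 0\<close> by simp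
    ultimately show "\<exists>D\<in>{0<..<1}. \<exists>t'>0. \<forall>y\<in>Y. \<forall>y'\<in>Y. M\<^sub>1 (g y) (g y') t \<ge> C \<longrightarrow> M\<^sub>2 y y' t' \<ge> D"
      using \<open>D \<in> {0<..<1}\<close> by blast
  qed
  ultimately show thesis
    using g by (intro that[of g]) (auto simp: coarse_embedding_def)
qed

theorem theorem4p4:
  fixes X :: "'a set" and Y :: "'b set"
    and M\<^sub>1 :: "'a \<Rightarrow> 'a \<Rightarrow> real \<Rightarrow> real" and M\<^sub>2 :: "'b \<Rightarrow> 'b \<Rightarrow> real \<Rightarrow> real"
    and T\<^sub>1 T\<^sub>2 :: "real \<Rightarrow> real \<Rightarrow> real"
    and f :: "'a \<Rightarrow> 'b"
  assumes "fuzzy_metric_space X M\<^sub>1 T\<^sub>1" and "fuzzy_metric_space Y M\<^sub>2 T\<^sub>2"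
    and "tnorm_no_zero_divisors T\<^sub>1" and "tnorm_no_zero_divisors T\<^sub>2"
    and "uniformly_locally_finite X M\<^sub>1" and "uniformly_locally_finite Y M\<^sub>2"
    and "f \<in> X \<rightarrow> Y"
    and "coarse_equivalence X M\<^sub>1 Y M\<^sub>2 f"
  shows "property_A X M\<^sub>1 \<longleftrightarrow> property_A Y M\<^sub>2"
proof
  assume "property_A X M\<^sub>1"
  \<comment> \<open>Property A travels against the direction of a map, so reaching \<open>Y\<close>
    from \<open>X\<close> takes a map from \<open>Y\<close> to \<open>X\<close>; the hypotheses on
    the codomain are then those on \<open>X\<close>.\<close>
  moreover obtain g where "g \<in> Y \<rightarrow> X" "coarse_embedding Y M\<^sub>2 M\<^sub>1 g"
    using coarse_equivalence_inverse[OF assms(2,4,7,8)] .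
  ultimately show "property_A Y M\<^sub>2"
    using property_A_coarse_embedding[OF assms(1,3,5)] by blast
next
  assume "property_A Y M\<^sub>2"
  then show "property_A X M\<^sub>1"
    using property_A_coarse_embedding[OF assms(2,4,6,7)] assms(8)
    by (simp add: coarse_equivalence_def)
qed

end
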